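(* For every $q$-holonomic sequence $(f_n(q))_n$ with $f_n(q)\in\mathbb{Z}[q^{\pm1}]$ and every complex root of unity $\zeta$, the sequence of evaluations $(f_n(\zeta))_n$ is a holonomic sequence.
   Context: A sequence $(f_n)_{n\in\mathbb{N}}$ of complex numbers is holonomic if it satisfies a linear recursion of the form $$c_d(n)f_{n+d}+\dots+c_0(n)f_n=0$$ for all $n$, where $c_j(n)\in K[n]$ are polynomials in $n$ with coefficients in a number field $K$ for $j=0,\dots,d$, with $c_d\neq0$. A sequence $(f_n(q))_{n\in\mathbb{N}}$ of rational functions of $q$ is $q$-holonomic if it satisfies a linear recursion of the form $$c_d(q^n,q)f_{n+d}(q)+\dots+c_0(q^n,q)f_n(q)=0$$ for all $n$, where $c_j(u,v)\in K[u,v]$ are polynomials in two variables $u$ and $v$ with coefficients in a number field $K$, for $j=0,\dots,d$, with $c_d\neq0$. *)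

theory Defs
  imports Complex_Main
    "HOL-Computational_Algebra.Computational_Algebra"
    "HOL-Computational_Algebra.Field_as_Ring"
begin

interpretation rat_complex: vector_space "\<lambda>(r::rat) (x::complex). of_rat r * x"
  by standard (simp_all add: algebra_simps of_rat_add of_rat_mult)

text \<open>
  Number fields are taken as subfields of the complex numbers of finite degree over the
  rationals. (Closure under inverse is harmless at 0, since inverse 0 = 0.)
\<close>

definition number_field :: "complex set \<Rightarrow> bool" where
  "number_field K \<longleftrightarrow>
     1 \<in> K \<and> (\<forall>x\<in>K. \<forall>y\<in>K. x - y \<in> K \<and> x * y \<in> K) \<and> (\<forall>x\<in>K. inverse x \<in> K) \<and>
     (\<exists>B. finite B \<and> K = rat_complex.span B)"

definition holonomic :: "(nat \<Rightarrow> complex) \<Rightarrow> bool" where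
  "holonomic f \<longleftrightarrow>
     (\<exists>K d (c :: nat \<Rightarrow> complex poly).
        number_field K \<and>
        (\<forall>j\<le>d. \<forall>i. coeff (c j) i \<in> K) \<and>
        c d \<noteq> 0 \<and>
        (\<forall>n. (\<Sum>j\<le>d. poly (c j) (of_nat n) * f (n + j)) = 0))"

text \<open>
  Rational functions of q are elements of the fraction field of the polynomials in q. A
  polynomial c(u,v) is a polynomial in u whose coefficients are polynomials in v, so
  substituting u = q^n and v = q amounts to evaluating the outer polynomial at the monomial q^n
  and reading v as q.
\<close>

definition subst_q :: "nat \<Rightarrow> complex poly poly \<Rightarrow> complex poly fract" where
  "subst_q n c = Fract (poly c (monom 1 n)) 1"

definition q_holonomic :: "(nat \<Rightarrow> complex poly fract) \<Rightarrow> bool" where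
  "q_holonomic f \<longleftrightarrow>
     (\<exists>K d (c :: nat \<Rightarrow> complex poly poly).
        number_field K \<and>
        (\<forall>j\<le>d. \<forall>i k. coeff (coeff (c j) i) k \<in> K) \<and>
        c d \<noteq> 0 \<and>
        (\<forall>n. (\<Sum>j\<le>d. subst_q n (c j) * f (n + j)) = 0))"

definition int_laurent_polys :: "complex poly fract set" where
  "int_laurent_polys = {Fract (map_poly of_int p) (monom 1 m) | (p :: int poly) (m :: nat). True}"

text \<open>
  The value of a rational function at a point which is not a pole, computed from its reduced
  fraction.
\<close>

definition eval_rat_fun :: "complex poly fract \<Rightarrow> complex \<Rightarrow> complex" where
  "eval_rat_fun r z =
     poly (fst (quot_of_fract r)) z / poly (snd (quot_of_fract r)) z"

lemma eval_rat_fun_Fract: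
  assumes "poly b z \<noteq> 0"
  shows "eval_rat_fun (Fract a b) z = poly a z / poly b z"
proof -
  define p where "p = fst (quot_of_fract (Fract a b))"
  define s where "s = snd (quot_of_fract (Fract a b))"
  have nz: "b \<noteq> 0" "s \<noteq> 0"
    using assms by (auto simp: s_def)
  have "Fract p s = Fract a b"
    by (simp add: p_def s_def)
  then have eq: "p * b = a * s"
    using nz by (simp add: eq_fract)
  have "coprime p s"
    using quot_of_fract_in_normalized_fracts[of "Fract a b"]
    by (auto simp: normalized_fracts_def p_def s_def case_prod_unfold)
  moreover have "s dvd p * b"
    by (simp add: eq)
  ultimately have "s dvd b"
    by (simp add: coprime_dvd_mult_right_iff coprime_commute)
  then have "poly s z \<noteq> 0"
    using assms by (auto elim!: dvdE)
  moreover have "poly p z * poly b z = poly a z * poly s z"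
    using arg_cong[OF eq, of "\<lambda>r. poly r z"] by simp
  ultimately show ?thesis
    using assms by (simp add: eval_rat_fun_def p_def s_def field_simps)
qed

definition root_of_unity :: "complex \<Rightarrow> bool" where
  "root_of_unity z \<longleftrightarrow> (\<exists>N>0. z ^ N = 1)"

end

theory Submission
  imports Defs
begin

text \<open>
  Let $\sum_{l \le d} c_l(q^n, q) f_{n+l} = 0$ be the given recursion and let $\zeta^N = 1$.

  Expanding each coefficient at $q = \zeta$ and taking the lowest order in $q - \zeta$ that occurs
  gives a recursion for $f_n(\zeta)$, because the $f_n$ have no pole at $\zeta$. However, the
  expansion of $c_l(q^n, q)$ involves $\zeta^n$, so this recursion depends on the residue class of
  $n$ modulo $N$, and the recursions for the various classes may fail to determine an
  overall recursion.

  The dependence on the class disappears if $u = q^n$ enters the coefficients only through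
  $u^N$: the coefficients of $(q - \zeta)^l$ in $q^{ne}$, for $N \mid e$, are
  $\binom{ne}{l} \zeta^{-l}$, and these are polynomials in $n$
  (\<open>taylor_coeff_poly_fun\<close>). So it suffices to find a nonzero left multiple $L = AP$ of the
  operator $P = \sum_l c_l(u, q) E^l$, where $E u = q u E$, whose coefficients are polynomials in
  $u^N$. Such a multiple exists by counting (\<open>skew_multiple_in_powers\<close>): for $A$ of order
  $m = (N - 1) d$ and of $u$-degree $< X$ there are $X (m + 1)$ unknown coefficients in the
  polynomials in $q$, while roughly $(1 - 1/N) X (m + 1 + d)$ coefficients of $AP$ have to vanish,
  and $(1 - 1/N)(m + 1 + d) < m + 1$. A homogeneous linear system with more unknowns than equations
  over an integral domain has a nontrivial solution, and $AP \neq 0$ since its leading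
  coefficient is that of $A$ times a $q$-shift of that of $P$.

  The resulting recursion has coefficients in $K(\zeta)$, which is again a number field.
\<close>


section \<open>Subrings and polynomials with coefficients in a subring\<close>

text \<open>
  Coefficients are confined to subsets of an ambient ring type, since the number field is such a
  subset; the predicate is applied to number fields and to iterated polynomial rings over them.
\<close>

definition unital_subring :: "'a::comm_ring_1 set \<Rightarrow> bool" where
  "unital_subring R \<longleftrightarrow> 1 \<in> R \<and> (\<forall>x\<in>R. \<forall>y\<in>R. x - y \<in> R \<and> x * y \<in> R)"

context
  fixes R :: "'a::comm_ring_1 set"
  assumes R: "unital_subring R"
begin

lemma unital_subring_1: "1 \<in> R"
  using R by (simp add: unital_subring_def)

lemma unital_subring_diff: "x \<in> R \<Longrightarrow> y \<in> R \<Longrightarrow> x - y \<in> R"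
  using R by (simp add: unital_subring_def)

lemma unital_subring_mult: "x \<in> R \<Longrightarrow> y \<in> R \<Longrightarrow> x * y \<in> R"
  using R by (simp add: unital_subring_def)

lemma unital_subring_0: "0 \<in> R"
  using unital_subring_diff[OF unital_subring_1 unital_subring_1] by simp

lemma unital_subring_uminus: "x \<in> R \<Longrightarrow> - x \<in> R"
  using unital_subring_diff[OF unital_subring_0] by fastforce

lemma unital_subring_add: "x \<in> R \<Longrightarrow> y \<in> R \<Longrightarrow> x + y \<in> R"
  using unital_subring_diff[of x "- y"] unital_subring_uminus by simp

lemma unital_subring_sum: "(\<And>i. i \<in> A \<Longrightarrow> g i \<in> R) \<Longrightarrow> sum g A \<in> R"
  by (induction A rule: infinite_finite_induct) (auto intro: unital_subring_0 unital_subring_add)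

lemma unital_subring_prod: "(\<And>i. i \<in> A \<Longrightarrow> g i \<in> R) \<Longrightarrow> prod g A \<in> R"
  by (induction A rule: infinite_finite_induct) (auto intro: unital_subring_1 unital_subring_mult)

lemma unital_subring_power: "x \<in> R \<Longrightarrow> x ^ n \<in> R"
  by (induction n) (auto intro: unital_subring_1 unital_subring_mult)

lemma unital_subring_of_nat: "of_nat n \<in> R"
  by (induction n) (auto intro: unital_subring_0 unital_subring_1 unital_subring_add)

lemmas unital_subring_intros =
  unital_subring_0 unital_subring_1 unital_subring_diff unital_subring_mult unital_subring_uminus
  unital_subring_add unital_subring_sum unital_subring_prod unital_subring_power
  unital_subring_of_nat

end

text \<open>
  The subring $R[X]$. Iterating it, \<open>polys_over (polys_over R)\<close> consists of the polynomials in
  $u$ with coefficients in $R[v]$.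
\<close>

definition polys_over :: "'a::comm_ring_1 set \<Rightarrow> 'a poly set" where
  "polys_over R = {p. \<forall>i. coeff p i \<in> R}"

lemma polys_overI: "(\<And>i. coeff p i \<in> R) \<Longrightarrow> p \<in> polys_over R"
  by (simp add: polys_over_def)

lemma polys_overD: "p \<in> polys_over R \<Longrightarrow> coeff p i \<in> R"
  by (simp add: polys_over_def)

lemma unital_subring_polys_over:
  assumes "unital_subring R"
  shows "unital_subring (polys_over R)"
  unfolding unital_subring_def
  by (auto intro!: polys_overI unital_subring_intros[OF assms] dest: polys_overD
      simp: coeff_mult coeff_1)

lemma monom_in_polys_over:
  "unital_subring R \<Longrightarrow> a \<in> R \<Longrightarrow> monom a n \<in> polys_over R"
  by (auto intro!: polys_overI unital_subring_0)

lemma pCons_in_polys_over: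
  "a \<in> R \<Longrightarrow> p \<in> polys_over R \<Longrightarrow> pCons a p \<in> polys_over R"
  by (auto simp: coeff_pCons polys_over_def split: nat.splits)

lemma zero_in_polys_over: "unital_subring R \<Longrightarrow> 0 \<in> polys_over R"
  by (simp add: polys_over_def unital_subring_0)

lemma pcompose_in_polys_over:
  assumes R: "unital_subring R" and p: "p \<in> polys_over R" and q: "q \<in> polys_over R"
  shows "pcompose p q \<in> polys_over R"
proof -
  have R': "unital_subring (polys_over R)"
    using R by (rule unital_subring_polys_over)
  have "map_poly (\<lambda>x. [:x:]) p \<in> polys_over (polys_over R)"
    using p zero_in_polys_over[OF R]
    by (auto simp: coeff_map_poly intro!: polys_overI pCons_in_polys_over dest: polys_overD)
      (auto simp: coeff_pCons polys_over_def unital_subring_0[OF R] split: nat.splits)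
  then show ?thesis
    unfolding pcompose_altdef poly_altdef
    by (intro unital_subring_sum[OF R'] unital_subring_mult[OF R'] unital_subring_power[OF R']
        q polys_overD)
qed


section \<open>Homogeneous linear systems over a subring of an integral domain\<close>

text \<open>
  By elimination without division: a nonzero entry $M_{ep}$ serves as pivot, and the remaining rows
  are multiplied by it before the unknown $p$ is eliminated, which keeps all entries in $R$.
\<close>

lemma homogeneous_system_nontrivial_solution:
  fixes M :: "'e \<Rightarrow> 'i \<Rightarrow> 'a::idom"
  assumes R: "unital_subring R" and fin: "finite E" "finite I" and card: "card E < card I"
    and M: "\<And>e i. e \<in> E \<Longrightarrow> i \<in> I \<Longrightarrow> M e i \<in> R"
  obtains x where "\<And>i. i \<in> I \<Longrightarrow> x i \<in> R" "\<exists>i\<in>I. x i \<noteq> 0"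
    "\<And>e. e \<in> E \<Longrightarrow> (\<Sum>i\<in>I. M e i * x i) = 0"
proof -
  note intros = unital_subring_intros[OF R]
  have "\<exists>x. (\<forall>i\<in>I. x i \<in> R) \<and> (\<exists>i\<in>I. x i \<noteq> 0) \<and> (\<forall>e\<in>E. (\<Sum>i\<in>I. M e i * x i) = 0)"
    using fin card M
  proof (induction E arbitrary: I M rule: finite_induct)
    case empty
    then show ?case
      by (intro exI[of _ "\<lambda>_. 1"]) (auto intro: intros simp: card_gt_0_iff)
  next
    case (insert e E I M)
    show ?case
    proof (cases "\<forall>i\<in>I. M e i = 0")
      case True
      have "\<exists>x. (\<forall>i\<in>I. x i \<in> R) \<and> (\<exists>i\<in>I. x i \<noteq> 0) \<and> (\<forall>e\<in>E. (\<Sum>i\<in>I. M e i * x i) = 0)"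
        by (rule insert.IH) (use insert in auto)
      then show ?thesis
        using True by auto
    next
      case False
      then obtain p where p: "p \<in> I" "M e p \<noteq> 0"
        by auto
      define M' where "M' = (\<lambda>e' i. M e p * M e' i - M e' p * M e i)"
      have "\<exists>y. (\<forall>i\<in>I-{p}. y i \<in> R) \<and> (\<exists>i\<in>I-{p}. y i \<noteq> 0) \<and>
          (\<forall>e'\<in>E. (\<Sum>i\<in>I-{p}. M' e' i * y i) = 0)"
        by (rule insert.IH) (use insert p in \<open>auto simp: M'_def intro!: intros\<close>)
      then obtain y where y: "\<And>i. i \<in> I - {p} \<Longrightarrow> y i \<in> R" "\<exists>i\<in>I-{p}. y i \<noteq> 0"
        "\<And>e'. e' \<in> E \<Longrightarrow> (\<Sum>i\<in>I-{p}. M' e' i * y i) = 0"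
        by blast
      define x where
        "x i = (if i = p then - (\<Sum>i\<in>I-{p}. M e i * y i) else M e p * y i)" for i
      have split: "(\<Sum>i\<in>I. M e' i * x i) = (\<Sum>i\<in>I-{p}. M' e' i * y i)" for e'
      proof -
        have "(\<Sum>i\<in>I. M e' i * x i) = M e' p * x p + (\<Sum>i\<in>I-{p}. M e' i * x i)"
          using p insert.prems by (simp add: sum.remove)
        also have "(\<Sum>i\<in>I-{p}. M e' i * x i) = (\<Sum>i\<in>I-{p}. M e' i * (M e p * y i))"
          by (intro sum.cong) (auto simp: x_def)
        also have "M e' p * x p = - (\<Sum>i\<in>I-{p}. M e' p * (M e i * y i))"
          by (simp add: x_def sum_distrib_left)
        finally show ?thesis
          by (simp add: M'_def algebra_simps sum_subtractf)
      qed
      have "\<forall>i\<in>I. x i \<in> R"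
        using y(1) p insert.prems(3) by (auto simp: x_def intro!: intros)
      moreover have "\<exists>i\<in>I. x i \<noteq> 0"
        using y(2) p by (auto simp: x_def)
      moreover have "\<forall>e'\<in>insert e E. (\<Sum>i\<in>I. M e' i * x i) = 0"
        using y(3) by (auto simp: split) (simp add: M'_def)
      ultimately show ?thesis
        by blast
    qed
  qed
  then show ?thesis
    using that by blast
qed


section \<open>Adjoining a root of unity to a number field\<close>

lemma rat_complex_linear_mult: 
  "Vector_Spaces.linear (\<lambda>r x. of_rat r * x) (\<lambda>r x. of_rat r * x) ((*) (a::complex))"
  by unfold_locales (simp_all add: algebra_simps of_rat_add of_rat_mult)

interpretation rat_complex_pair: vector_space_pair
  "\<lambda>(r::rat) (x::complex). of_rat r * x" "\<lambda>(r::rat) (x::complex). of_rat r * x"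
  by unfold_locales

lemma mult_span_closed:
  assumes "\<And>b. b \<in> B \<Longrightarrow> a * b \<in> rat_complex.span C" and "x \<in> rat_complex.span B"
  shows "a * x \<in> rat_complex.span C"
proof -
  have "a * x \<in> (*) a ` rat_complex.span B"
    using assms(2) by blast
  also have "\<dots> = rat_complex.span ((*) a ` B)"
    by (simp add: rat_complex_pair.linear_span_image[OF rat_complex_linear_mult])
  also have "\<dots> \<subseteq> rat_complex.span C"
    using assms(1) by (intro rat_complex.span_minimal rat_complex.subspace_span) auto
  finally show ?thesis .
qed

text \<open>
  Multiplication by $x \neq 0$ is an injective endomorphism of a finite-dimensional space, hence
  maps a basis $C$ to a basis $D$, and so attains the value 1.
\<close>

lemma finite_span_inverse_closed:
  assumes B: "finite B" and one: "1 \<in> rat_complex.span B"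
    and x: "x \<in> rat_complex.span B"
    and mult: "\<And>y. y \<in> rat_complex.span B \<Longrightarrow> x * y \<in> rat_complex.span B"
  shows "inverse x \<in> rat_complex.span B"
proof (cases "x = 0")
  case True
  then show ?thesis
    using rat_complex.span_zero by simp
next
  case False
  obtain C where C: "C \<subseteq> B" "rat_complex.independent C" "B \<subseteq> rat_complex.span C"
    using rat_complex.maximal_independent_subset by blast
  have span: "rat_complex.span C = rat_complex.span B"
    by (intro antisym rat_complex.span_mono rat_complex.span_minimal rat_complex.subspace_span C)
  have finC: "finite C"
    using B C(1) finite_subset by blast
  define D where "D = (*) x ` C"
  have inj: "inj_on ((*) x) A" for A
    using False by (auto simp: inj_on_def)
  have D: "rat_complex.independent D"
    unfolding D_def
    by (rule rat_complex_pair.linear_independent_injective_image[OF rat_complex_linear_mult C(2) inj])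
  have sub: "D \<subseteq> rat_complex.span C"
    using mult C(1) rat_complex.span_base by (auto simp: D_def span)
  have "1 \<in> rat_complex.span D"
  proof (rule ccontr)
    assume "1 \<notin> rat_complex.span D"
    then have "rat_complex.independent (insert 1 D)" "1 \<notin> D"
      using D rat_complex.independent_insertI rat_complex.span_base by auto
    moreover have "insert 1 D \<subseteq> rat_complex.span C"
      using one sub by (simp add: span)
    ultimately have "card (insert 1 D) \<le> card C"
      using rat_complex.independent_span_bound[OF finC] by blast
    moreover have "card D = card C"
      unfolding D_def by (rule card_image[OF inj])
    ultimately show False
      using \<open>1 \<notin> D\<close> finC by (simp add: D_def)
  qed
  then have "1 \<in> (*) x ` rat_complex.span C"
    unfolding D_def by (simp add: rat_complex_pair.linear_span_image[OF rat_complex_linear_mult])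
  then obtain y where "1 = x * y" "y \<in> rat_complex.span B"
    by (auto simp: span)
  then show ?thesis
    using inverse_unique[of x y] by simp
qed

lemma unital_subring_number_field: "number_field K \<Longrightarrow> unital_subring K"
  by (simp add: number_field_def unital_subring_def)

lemma number_field_adjoin_root_of_unity:
  assumes K: "number_field K" and z: "root_of_unity z"
  obtains L where "number_field L" "K \<subseteq> L" "z \<in> L"
proof -
  obtain B where B: "finite B" "K = rat_complex.span B"
    using K by (auto simp: number_field_def)
  obtain N where N: "N > 0" "z ^ N = 1"
    using z by (auto simp: root_of_unity_def)
  have one: "1 \<in> K" and multK: "\<And>x y. x \<in> K \<Longrightarrow> y \<in> K \<Longrightarrow> x * y \<in> K"
    using K by (auto simp: number_field_def)
  define C where "C = (\<lambda>(b,i). b * z ^ i) ` (B \<times> {..<N})"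
  define L where "L = rat_complex.span C"
  have pow: "z ^ i = z ^ (i mod N)" for i
  proof -
    have "z ^ i = (z ^ N) ^ (i div N) * z ^ (i mod N)"
      by (metis mult_div_mod_eq power_add power_mult)
    then show ?thesis
      by (simp add: N)
  qed
  have KL: "x * z ^ i \<in> L" if "x \<in> K" for x i
  proof -
    have "z ^ i * x \<in> L"
      unfolding L_def
    proof (rule mult_span_closed)
      show "x \<in> rat_complex.span B"
        using that B by simp
      fix b assume "b \<in> B"
      then have "b * z ^ (i mod N) \<in> C"
        using N(1) by (force simp: C_def)
      then show "z ^ i * b \<in> rat_complex.span C"
        using pow[of i] rat_complex.span_base by (simp add: mult.commute)
    qed
    then show ?thesis
      by (simp add: mult.commute)
  qed
  have mult: "x * y \<in> L" if "x \<in> L" "y \<in> L" for x y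
    unfolding L_def
  proof (rule mult_span_closed)
    show "y \<in> rat_complex.span C"
      using that by (simp add: L_def)
    fix c assume "c \<in> C"
    then obtain b i where c: "b \<in> B" "c = b * z ^ i"
      by (auto simp: C_def)
    have "c * x \<in> rat_complex.span C"
    proof (rule mult_span_closed)
      show "x \<in> rat_complex.span C"
        using that by (simp add: L_def)
      fix c' assume "c' \<in> C"
      then obtain b' i' where c': "b' \<in> B" "c' = b' * z ^ i'"
        by (auto simp: C_def)
      have "(b * b') * z ^ (i + i') \<in> L"
        using c c' B by (intro KL multK) (auto intro: rat_complex.span_base)
      then show "c * c' \<in> rat_complex.span C"
        by (simp add: c c' L_def power_add mult_ac)
    qed
    then show "x * c \<in> rat_complex.span C"
      by (simp add: mult.commute)
  qed
  have finC: "finite C"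
    using B by (simp add: C_def)
  have KsubL: "K \<subseteq> L"
    using KL[of _ 0] by auto
  have "number_field L"
    unfolding number_field_def
  proof (intro conjI ballI)
    show "\<exists>B. finite B \<and> L = rat_complex.span B"
      using finC L_def by blast
    fix x assume x: "x \<in> L"
    show "inverse x \<in> L"
      using finite_span_inverse_closed[OF finC, of x] KsubL one x mult by (auto simp: L_def)
  next
    fix x y assume "x \<in> L" "y \<in> L"
    then show "x - y \<in> L" "x * y \<in> L"
      using mult by (auto simp: L_def intro: rat_complex.span_diff)
  qed (use one KsubL in auto)
  then show ?thesis
    using that KsubL KL[OF one, of 1] by simp
qed


section \<open>Left multiples of a $q$-difference operator\<close>

text \<open>
  The substitution $c(u, v) \mapsto c(v^s u, v)$. It is the effect on coefficients of moving the
  shift operator $E^s$ past them, as $q^{n+s} = q^s q^n$.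
\<close>

definition q_shift :: "nat \<Rightarrow> 'a::comm_ring_1 poly poly \<Rightarrow> 'a poly poly" where
  "q_shift s c = pcompose c [:0, monom 1 s:]"

lemma coeff_q_shift: "coeff (q_shift s c) i = monom 1 (s * i) * coeff c i"
  by (simp add: q_shift_def coeff_pcompose_linear monom_power)

lemma q_shift_eq_0_iff: "q_shift s c = 0 \<longleftrightarrow> c = (0 :: 'a::idom poly poly)"
  by (simp add: q_shift_def pcompose_eq_0_iff)

lemma q_shift_in_polys_over:
  assumes "unital_subring R" "c \<in> polys_over (polys_over R)"
  shows "q_shift s c \<in> polys_over (polys_over R)"
  using assms unital_subring_polys_over[of R]
  by (auto intro!: polys_overI[where p = "q_shift s c"] unital_subring_mult
      monom_in_polys_over unital_subring_1 dest: polys_overD simp: coeff_q_shift)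

lemma subst_q_shift: "subst_q n (q_shift s c) = subst_q (n + s) c"
  by (simp add: subst_q_def q_shift_def poly_pcompose mult_monom)

lemma subst_q_mult: "subst_q n (a * b) = subst_q n a * subst_q n b"
  by (simp add: subst_q_def)

lemma subst_q_0: "subst_q n 0 = 0"
  by (simp add: subst_q_def Zero_fract_def)

lemma Fract_add_1: "Fract (a + b) 1 = Fract a 1 + Fract b 1"
  by simp

lemma Fract_sum: "Fract (sum g A) 1 = (\<Sum>i\<in>A. Fract (g i) 1)"
  by (induction A rule: infinite_finite_induct) (simp_all add: Fract_add_1 del: add_fract flip: Zero_fract_def)

lemma subst_q_sum: "subst_q n (sum g A) = (\<Sum>i\<in>A. subst_q n (g i))"
  by (simp add: subst_q_def poly_sum Fract_sum)

text \<open>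
  The coefficient of $E^t$ in the product of the operators $\sum_{s \le m} a_s E^s$ and
  $\sum_{l \le d} c_l E^l$.
\<close>

definition skew_mult ::
  "nat \<Rightarrow> (nat \<Rightarrow> 'a::comm_ring_1 poly poly) \<Rightarrow> nat \<Rightarrow> (nat \<Rightarrow> 'a poly poly) \<Rightarrow> nat \<Rightarrow> 'a poly poly" where
  "skew_mult m a d c t =
     (\<Sum>s\<le>m. \<Sum>l\<le>d. if s + l = t then a s * q_shift s (c l) else 0)"

lemma skew_mult_annihilates:
  assumes "\<And>n. (\<Sum>l\<le>d. subst_q n (c l) * f (n + l)) = 0"
  shows "(\<Sum>t\<le>m + d. subst_q n (skew_mult m a d c t) * f (n + t)) = 0"
proof -
  have "(\<Sum>t\<le>m + d. subst_q n (skew_mult m a d c t) * f (n + t)) =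
      (\<Sum>t\<le>m + d. \<Sum>s\<le>m. \<Sum>l\<le>d.
         if t = s + l then subst_q n (a s) * (subst_q (n + s) (c l) * f (n + s + l)) else 0)"
    unfolding skew_mult_def subst_q_sum sum_distrib_right
    by (intro sum.cong refl) (auto simp: subst_q_mult subst_q_shift subst_q_0 add_ac mult_ac)
  also have "\<dots> = (\<Sum>s\<le>m. \<Sum>t\<le>m + d. \<Sum>l\<le>d.
         if t = s + l then subst_q n (a s) * (subst_q (n + s) (c l) * f (n + s + l)) else 0)"
    by (rule sum.swap)
  also have "\<dots> = (\<Sum>s\<le>m. \<Sum>l\<le>d. \<Sum>t\<le>m + d.
         if t = s + l then subst_q n (a s) * (subst_q (n + s) (c l) * f (n + s + l)) else 0)"
    by (intro sum.cong refl sum.swap)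
  also have "\<dots> = (\<Sum>s\<le>m. \<Sum>l\<le>d. subst_q n (a s) * (subst_q (n + s) (c l) * f (n + s + l)))"
    by (intro sum.cong refl) (simp add: sum.delta)
  also have "\<dots> = (\<Sum>s\<le>m. subst_q n (a s) * (\<Sum>l\<le>d. subst_q (n + s) (c l) * f (n + s + l)))"
    by (simp add: sum_distrib_left)
  also have "\<dots> = 0"
    using assms by simp
  finally show ?thesis .
qed

lemma skew_mult_nonzero:
  fixes a c :: "nat \<Rightarrow> 'a::idom poly poly"
  assumes "\<exists>s\<le>m. a s \<noteq> 0" and "c d \<noteq> 0"
  obtains t where "t \<le> m + d" "skew_mult m a d c t \<noteq> 0"
proof -
  define s0 where "s0 = Max {s. s \<le> m \<and> a s \<noteq> 0}"
  have "s0 \<in> {s. s \<le> m \<and> a s \<noteq> 0}"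
    unfolding s0_def using assms(1) by (intro Max_in) auto
  then have s0: "s0 \<le> m" "a s0 \<noteq> 0"
    by auto
  have s0_max: "a s = 0" if "s \<le> m" "s > s0" for s
  proof (rule ccontr)
    assume "a s \<noteq> 0"
    then have "s \<le> s0"
      unfolding s0_def using that by (intro Max_ge) auto
    then show False
      using that by simp
  qed
  have "skew_mult m a d c (s0 + d) = (\<Sum>s\<le>m. if s = s0 then a s * q_shift s (c d) else 0)"
    unfolding skew_mult_def
  proof (intro sum.cong refl)
    fix s assume s: "s \<in> {..m}"
    show "(\<Sum>l\<le>d. if s + l = s0 + d then a s * q_shift s (c l) else 0) =
        (if s = s0 then a s * q_shift s (c d) else 0)"
    proof (cases "s = s0")
      case False
      have "(if s + l = s0 + d then a s * q_shift s (c l) else 0) = 0" if "l \<le> d" for l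
        using s0_max[of s] s False that by (cases "s < s0") auto
      then show ?thesis
        using False by simp
    qed simp
  qed
  also have "\<dots> = a s0 * q_shift s0 (c d)"
    using s0 by simp
  also have "\<dots> \<noteq> 0"
    using s0 assms(2) by (simp add: q_shift_eq_0_iff)
  finally show ?thesis
    using that[of "s0 + d"] s0(1) by simp
qed

lemma skew_mult_in_polys_over:
  assumes R: "unital_subring R"
    and a: "\<And>s. s \<le> m \<Longrightarrow> a s \<in> polys_over (polys_over R)"
    and c: "\<And>l. l \<le> d \<Longrightarrow> c l \<in> polys_over (polys_over R)"
  shows "skew_mult m a d c t \<in> polys_over (polys_over R)"
proof -
  note intros = unital_subring_intros[OF unital_subring_polys_over[OF unital_subring_polys_over[OF R]]]
  show ?thesis
    unfolding skew_mult_def using a c by (auto intro!: intros q_shift_in_polys_over[OF R])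
qed

lemma card_not_dvd_lessThan:
  fixes N T :: nat
  assumes "N > 0"
  shows "card {e. e < N * T \<and> \<not> N dvd e} = (N - 1) * T"
proof -
  have eq: "{e. e < N * T \<and> N dvd e} = (*) N ` {..<T}"
    using assms by (auto elim!: dvdE)
  have "card {e. e < N * T \<and> N dvd e} = T"
    unfolding eq using assms by (subst card_image) (auto simp: inj_on_def)
  moreover have "{e. e < N * T \<and> \<not> N dvd e} = {..<N * T} - {e. e < N * T \<and> N dvd e}"
    by auto
  ultimately have "card {e. e < N * T \<and> \<not> N dvd e} = N * T - T"
    by (simp add: card_Diff_subset subset_eq)
  then show ?thesis
    by (simp add: diff_mult_distrib)
qed

text \<open>
  The left multiple whose coefficients involve only powers of $u^N$. The unknowns are the
  coefficients of $u^i E^s$ in the left factor, for $i < X$ and $s \le m$. The equations are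
  indexed by the $u^e E^t$ with $e < NT$, $N \nmid e$ and $t \le m + d$; here $NT = X + g$, where
  $g$ bounds the $u$-degrees of the $c_l$, so that higher powers of $u$ do not occur in the product.
\<close>

lemma skew_multiple_in_powers:
  fixes c :: "nat \<Rightarrow> 'a::idom poly poly"
  assumes R: "unital_subring R" and c: "\<And>l. l \<le> d \<Longrightarrow> c l \<in> polys_over (polys_over R)"
    and N: "N > 0"
  obtains m a where "\<And>s. s \<le> m \<Longrightarrow> a s \<in> polys_over (polys_over R)" "\<exists>s\<le>m. a s \<noteq> 0"
    "\<And>t e. t \<le> m + d \<Longrightarrow> \<not> N dvd e \<Longrightarrow> coeff (skew_mult m a d c t) e = 0"
proof -
  define m where "m = (N - 1) * d"
  define g where "g = (\<Sum>l\<le>d. degree (c l))"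
  define T where "T = g * (m + 1) + 1"
  define X where "X = N * T - g"
  \<comment> \<open>The choice of $m$ makes the number of unknowns exceed that of equations by
    $T - g (m + 1)$, which the choice of $T$ makes equal to 1.\<close>
  have "g < T"
    by (simp add: T_def)
  also have "T \<le> N * T"
    using N by simp
  finally have gX: "X + g = N * T"
    by (simp add: X_def)
  define I where "I = {..<X} \<times> {..m}"
  define E where "E = {e. e < N * T \<and> \<not> N dvd e} \<times> {..m + d}"
  define M where "M = (\<lambda>(e,t) (i,s).
    \<Sum>l\<le>d. if s + l = t then coeff (monom 1 i * q_shift s (c l)) e else 0)"
  have R1: "unital_subring (polys_over R)"
    using R by (rule unital_subring_polys_over)
  note intros = unital_subring_intros[OF R1]
  have R2: "unital_subring (polys_over (polys_over R))"
    using R1 by (rule unital_subring_polys_over)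
  have "card E < card I"
  proof -
    obtain N' where N': "N = Suc N'"
      using N by (cases N) auto
    have "card E + g * (m + 1) < (X + g) * (m + 1)"
      unfolding gX by (simp add: E_def card_cartesian_product card_not_dvd_lessThan[OF N])
        (simp add: N' T_def m_def algebra_simps)
    then show ?thesis
      by (simp add: I_def card_cartesian_product add_mult_distrib)
  qed
  moreover have "finite E" "finite I"
    by (simp_all add: E_def I_def)
  moreover have "M e i \<in> polys_over R" if "e \<in> E" "i \<in> I" for e i
    unfolding M_def case_prod_unfold
    by (auto intro!: intros polys_overD unital_subring_mult[OF R2] q_shift_in_polys_over[OF R] c
        monom_in_polys_over[OF R1])
  ultimately obtain x where x: "\<And>i. i \<in> I \<Longrightarrow> x i \<in> polys_over R" "\<exists>i\<in>I. x i \<noteq> 0"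
    "\<And>e. e \<in> E \<Longrightarrow> (\<Sum>i\<in>I. M e i * x i) = 0"
    using homogeneous_system_nontrivial_solution[OF R1, of E I M] by blast
  define a where "a s = (\<Sum>i<X. monom (x (i, s)) i)" for s
  have coeff_a: "coeff (a s) i = (if i < X then x (i, s) else 0)" for s i
    by (simp add: a_def coeff_sum)
  show ?thesis
  proof
    show "a s \<in> polys_over (polys_over R)" if "s \<le> m" for s
      using that by (auto intro!: polys_overI[where p = "a s"] x intros simp: coeff_a I_def)
    obtain i s where "i < X" "s \<le> m" "x (i, s) \<noteq> 0"
      using x(2) by (auto simp: I_def)
    then have "coeff (a s) i \<noteq> 0"
      by (simp add: coeff_a)
    then show "\<exists>s\<le>m. a s \<noteq> 0"
      using \<open>s \<le> m\<close> by (metis coeff_0)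
    fix t e :: nat
    assume te: "t \<le> m + d" "\<not> N dvd e"
    show "coeff (skew_mult m a d c t) e = 0"
    proof (cases "e < N * T")
      case True
      have "coeff (skew_mult m a d c t) e =
          (\<Sum>s\<le>m. \<Sum>l\<le>d. if s + l = t then coeff (a s * q_shift s (c l)) e else 0)"
        by (auto simp: skew_mult_def coeff_sum intro!: sum.cong)
      also have "\<dots> = (\<Sum>s\<le>m. \<Sum>l\<le>d. \<Sum>i<X.
          if s + l = t then coeff (monom 1 i * q_shift s (c l)) e * x (i, s) else 0)"
      proof (intro sum.cong refl)
        fix s l
        have "a s * q_shift s (c l) = (\<Sum>i<X. smult (x (i, s)) (monom 1 i * q_shift s (c l)))"
          by (simp add: a_def sum_distrib_right smult_monom flip: mult_smult_left)
        then show "(if s + l = t then coeff (a s * q_shift s (c l)) e else 0) =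
          (\<Sum>i<X. if s + l = t then coeff (monom 1 i * q_shift s (c l)) e * x (i, s) else 0)"
          by (simp add: coeff_sum mult.commute)
      qed
      also have "\<dots> = (\<Sum>s\<le>m. \<Sum>i<X. \<Sum>l\<le>d.
          if s + l = t then coeff (monom 1 i * q_shift s (c l)) e * x (i, s) else 0)"
        by (intro sum.cong refl sum.swap)
      also have "\<dots> = (\<Sum>i<X. \<Sum>s\<le>m. \<Sum>l\<le>d.
          if s + l = t then coeff (monom 1 i * q_shift s (c l)) e * x (i, s) else 0)"
        by (rule sum.swap)
      also have "\<dots> = (\<Sum>i<X. \<Sum>s\<le>m. M (e, t) (i, s) * x (i, s))"
        by (intro sum.cong refl) (auto simp: M_def sum_distrib_right intro!: sum.cong)
      also have "\<dots> = (\<Sum>i\<in>I. M (e, t) i * x i)"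
        by (simp add: I_def sum.cartesian_product case_prod_unfold)
      also have "\<dots> = 0"
        using x(3)[of "(e, t)"] True te by (simp add: E_def)
      finally show ?thesis .
    next
      case False
      have "coeff (a s * q_shift s (c l)) e = 0" if "l \<le> d" for s l
        unfolding coeff_mult
      proof (intro sum.neutral ballI)
        fix i
        have "degree (c l) \<le> g"
          unfolding g_def using that by (intro member_le_sum) auto
        then have "coeff (c l) (e - i) = 0" if "i < X"
          using that False gX by (intro coeff_eq_0) linarith
        then show "coeff (a s) i * coeff (q_shift s (c l)) (e - i) = 0"
          by (auto simp: coeff_a coeff_q_shift)
      qed
      then show ?thesis
        by (auto simp: skew_mult_def coeff_sum intro!: sum.neutral)
    qed
  qed
qed


section \<open>Taylor coefficients at a root of unity\<close>

text \<open>The sequences given by a polynomial in $n$ with coefficients in $R$.\<close>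

definition poly_fun_over :: "'a::comm_ring_1 set \<Rightarrow> (nat \<Rightarrow> 'a) \<Rightarrow> bool" where
  "poly_fun_over R g \<longleftrightarrow> (\<exists>p\<in>polys_over R. \<forall>n. g n = poly p (of_nat n))"

lemma poly_fun_over_const: "unital_subring R \<Longrightarrow> a \<in> R \<Longrightarrow> poly_fun_over R (\<lambda>_. a)"
  unfolding poly_fun_over_def
  by (intro bexI[of _ "[:a:]"]) (auto intro!: pCons_in_polys_over zero_in_polys_over)

lemma poly_fun_over_add:
  "unital_subring R \<Longrightarrow> poly_fun_over R g \<Longrightarrow> poly_fun_over R h \<Longrightarrow> poly_fun_over R (\<lambda>n. g n + h n)"
  unfolding poly_fun_over_def
  using unital_subring_add[OF unital_subring_polys_over[of R]] by (metis poly_add)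

lemma poly_fun_over_mult:
  "unital_subring R \<Longrightarrow> poly_fun_over R g \<Longrightarrow> poly_fun_over R h \<Longrightarrow> poly_fun_over R (\<lambda>n. g n * h n)"
  unfolding poly_fun_over_def
  using unital_subring_mult[OF unital_subring_polys_over[of R]] by (metis poly_mult)

lemma poly_fun_over_sum:
  assumes "unital_subring R" "\<And>i. i \<in> A \<Longrightarrow> poly_fun_over R (g i)"
  shows "poly_fun_over R (\<lambda>n. \<Sum>i\<in>A. g i n)"
  using assms(2)
  by (induction A rule: infinite_finite_induct)
    (auto intro: poly_fun_over_const poly_fun_over_add unital_subring_0 assms(1))

lemma poly_fun_over_binomial:
  fixes R :: "'a::field_char_0 set"
  assumes R: "unital_subring R" and inv: "\<And>x. x \<in> R \<Longrightarrow> inverse x \<in> R"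
  shows "poly_fun_over R (\<lambda>n. of_nat (n * i choose l))"
proof -
  note intros = unital_subring_intros[OF unital_subring_polys_over[OF R]]
  define p :: "'a poly" where "p = (\<Prod>j=0..<l. [:- of_nat j, of_nat i:]) * [:inverse (of_nat (fact l)):]"
  have "p \<in> polys_over R"
    unfolding p_def
    by (intro intros pCons_in_polys_over zero_in_polys_over unital_subring_intros[OF R] inv R)
  moreover have "of_nat (n * i choose l) = poly p (of_nat n)" for n
    by (simp add: p_def poly_prod binomial_gbinomial gbinomial_prod_rev field_simps)
  ultimately show ?thesis
    unfolding poly_fun_over_def by blast
qed

lemma pcompose_monom_1: "pcompose (monom 1 n) q = (q :: 'a::comm_semiring_1 poly) ^ n"
  by (induction n) (simp_all add: monom_0 monom_Suc pcompose_pCons one_pCons)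

lemma coeff_linear_power_root_of_unity:
  fixes z :: "'a::field"
  assumes "z ^ N = 1" "N > 0" "N dvd i"
  shows "coeff ([:z, 1:] ^ (n * i)) l = of_nat (n * i choose l) * inverse z ^ l"
proof (cases "l \<le> n * i")
  case True
  have z: "z \<noteq> 0"
    using assms(1,2) by (auto simp: power_0_left)
  obtain j where "i = N * j"
    using assms(3) by (elim dvdE)
  then have "z ^ (n * i) = (z ^ N) ^ (n * j)"
    by (simp add: mult.left_commute flip: power_mult)
  then have "z ^ (n * i) = 1"
    using assms(1) by simp
  then have "z ^ (n * i - l) = inverse z ^ l"
    using True z by (simp add: power_diff field_simps)
  then show ?thesis
    using True by (simp add: coeff_linear_poly_power)
next
  case False
  then have "degree ([:z, 1:] ^ (n * i)) < l"
    by (simp add: degree_linear_power)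
  then show ?thesis
    using False by (simp add: coeff_eq_0 binomial_eq_0)
qed

text \<open>
  The coefficient of $(q - z)^k$ in $a(q^n, q)$ is a polynomial in $n$, uniformly in $n$, provided
  that $a$ contains only powers of $u$ divisible by $N$.
\<close>

lemma taylor_coeff_poly_fun:
  fixes z :: "'a::field_char_0"
  assumes R: "unital_subring R" and inv: "\<And>x. x \<in> R \<Longrightarrow> inverse x \<in> R"
    and z: "z \<in> R" "z ^ N = 1" "N > 0"
    and a: "a \<in> polys_over (polys_over R)" "\<And>e. \<not> N dvd e \<Longrightarrow> coeff a e = 0"
  shows "poly_fun_over R (\<lambda>n. coeff (pcompose (poly a (monom 1 n)) [:z, 1:]) k)"
proof -
  note intros = unital_subring_intros[OF R]
  have shift: "pcompose (coeff a i) [:z, 1:] \<in> polys_over R" for i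
    by (intro pcompose_in_polys_over[OF R] polys_overD[OF a(1)] pCons_in_polys_over
        zero_in_polys_over[OF R] intros z)
  have "coeff (pcompose (poly a (monom 1 n)) [:z, 1:]) k =
      (\<Sum>i\<le>degree a. \<Sum>l\<le>k. coeff (pcompose (coeff a i) [:z, 1:]) l *
         coeff ([:z, 1:] ^ (n * i)) (k - l))" for n
    by (simp add: poly_altdef monom_power pcompose_sum pcompose_mult pcompose_monom_1
        coeff_sum coeff_mult)
  moreover have "poly_fun_over R (\<lambda>n. coeff (pcompose (coeff a i) [:z, 1:]) l *
         coeff ([:z, 1:] ^ (n * i)) (k - l))" for i l
  proof (cases "N dvd i")
    case True
    then show ?thesis
      unfolding coeff_linear_power_root_of_unity[OF z(2,3) True]
      by (intro poly_fun_over_mult poly_fun_over_const poly_fun_over_binomial R polys_overD[OF shift]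
          intros inv z)
  next
    case False
    then show ?thesis
      using a(2) by (simp add: poly_fun_over_const R intros)
  qed
  ultimately show ?thesis
    by (simp only:) (intro poly_fun_over_sum R)
qed

text \<open>
  A nonzero $a(u, v)$ cannot vanish at all the pairwise distinct points $u = v^n$.
\<close>

lemma taylor_coeff_nonzero:
  fixes a :: "'a::idom poly poly"
  assumes "a \<noteq> 0"
  obtains n k where "coeff (pcompose (poly a (monom 1 n)) [:z, 1:]) k \<noteq> 0"
proof (rule ccontr)
  assume "\<not> thesis"
  with that have "pcompose (poly a (monom 1 n)) [:z, 1:] = 0" for n
    by (intro poly_eqI) auto
  then have "poly a (monom 1 n) = 0" for n
    by (simp add: pcompose_eq_0_iff)
  then have "range (monom 1) \<subseteq> {x. poly a x = 0}"
    by auto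
  moreover have "inj (monom (1::'a))"
    by (auto simp: inj_on_def monom_eq_iff')
  ultimately show False
    using poly_roots_finite[OF assms] finite_subset range_inj_infinite by blast
qed


section \<open>The recursion for the values\<close>

lemma int_laurent_poly_clear_denominator:
  fixes f :: "nat \<Rightarrow> complex poly fract"
  assumes "\<And>t. t \<le> d \<Longrightarrow> f t \<in> int_laurent_polys" and "z \<noteq> 0"
  obtains M Q where "\<And>t. t \<le> d \<Longrightarrow> Fract (monom 1 M) 1 * f t = Fract (Q t) 1"
    "\<And>t. t \<le> d \<Longrightarrow> poly (Q t) z = z ^ M * eval_rat_fun (f t) z"
proof -
  have "\<forall>t\<in>{..d}. \<exists>P m. f t = Fract P (monom 1 m)"
    using assms(1) by (fastforce simp: int_laurent_polys_def)
  then obtain P m where f: "\<And>t. t \<le> d \<Longrightarrow> f t = Fract (P t) (monom 1 (m t))"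
    by (metis atMost_iff)
  define M where "M = (\<Sum>t\<le>d. m t)"
  show ?thesis
  proof
    fix t assume t: "t \<le> d"
    have "m t \<le> M"
      unfolding M_def using t by (intro member_le_sum) auto
    then have M: "M = m t + (M - m t)"
      by simp
    show "Fract (monom 1 M) 1 * f t = Fract (monom 1 (M - m t) * P t) 1"
      using M by (simp add: f[OF t] eq_fract mult_monom algebra_simps)
    have "eval_rat_fun (f t) z = poly (P t) z / z ^ m t"
      using assms(2) by (simp add: f[OF t] eval_rat_fun_Fract poly_monom)
    moreover have "z ^ M = z ^ m t * z ^ (M - m t)"
      by (subst M) (simp add: power_add)
    ultimately show "poly (monom 1 (M - m t) * P t) z = z ^ M * eval_rat_fun (f t) z"
      using assms(2) by (simp add: poly_monom)
  qed
qed

text \<open>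
  The recursion for the values is the coefficient of the lowest power of $q - z$ in the given one.
  Only the values at $z$ of the Laurent polynomials enter it, since the coefficients of the
  recursion have no terms of lower order.
\<close>

lemma holonomic_if_recurrence_in_powers:
  assumes L: "number_field L" and z: "z \<in> L" "z ^ N = 1" "N > 0"
    and f: "\<And>n. f n \<in> int_laurent_polys"
    and c: "\<And>t. t \<le> d \<Longrightarrow> c t \<in> polys_over (polys_over L)"
      "\<And>t e. t \<le> d \<Longrightarrow> \<not> N dvd e \<Longrightarrow> coeff (c t) e = 0"
    and nz: "\<exists>t\<le>d. c t \<noteq> 0"
    and rec: "\<And>n. (\<Sum>t\<le>d. subst_q n (c t) * f (n + t)) = 0"
  shows "holonomic (\<lambda>n. eval_rat_fun (f n) z)"
proof -
  have R: "unital_subring L" and inv: "\<And>x. x \<in> L \<Longrightarrow> inverse x \<in> L"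
    using L by (auto simp: number_field_def unital_subring_number_field)
  have z0: "z \<noteq> 0"
    using z(2,3) by (auto simp: power_0_left)
  \<comment> \<open>\<open>b t n\<close> is the expansion of $c_t(q^n, q)$ in powers of $q - z$, and $k$ is the lowest order
    that occurs for any $t$ and $n$.\<close>
  define b where "b t n = pcompose (poly (c t) (monom 1 n)) [:z, 1:]" for t n
  define k where "k = (LEAST k. \<exists>t\<le>d. \<exists>n. coeff (b t n) k \<noteq> 0)"
  have "\<exists>k. \<exists>t\<le>d. \<exists>n. coeff (b t n) k \<noteq> 0"
    using nz taylor_coeff_nonzero unfolding b_def by metis
  then have k: "\<exists>t\<le>d. \<exists>n. coeff (b t n) k \<noteq> 0"
    unfolding k_def by (rule LeastI_ex)
  have below: "coeff (b t n) i = 0" if "t \<le> d" "i < k" for t n i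
    using not_less_Least[of i "\<lambda>k. \<exists>t\<le>d. \<exists>n. coeff (b t n) k \<noteq> 0"] that
    unfolding k_def by blast
  have "\<forall>t\<in>{..d}. poly_fun_over L (\<lambda>n. coeff (b t n) k)"
    unfolding b_def using taylor_coeff_poly_fun[OF R inv z] c by simp
  then obtain p where p: "\<And>t. t \<le> d \<Longrightarrow> p t \<in> polys_over L"
    "\<And>t n. t \<le> d \<Longrightarrow> coeff (b t n) k = poly (p t) (of_nat n)"
    unfolding poly_fun_over_def by (metis atMost_iff)
  have lowest: "(\<Sum>t\<le>d. poly (p t) (of_nat n) * eval_rat_fun (f (n + t)) z) = 0" for n
  proof -
    obtain M Q where Q: "\<And>t. t \<le> d \<Longrightarrow> Fract (monom 1 M) 1 * f (n + t) = Fract (Q t) 1"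
      "\<And>t. t \<le> d \<Longrightarrow> poly (Q t) z = z ^ M * eval_rat_fun (f (n + t)) z"
      using int_laurent_poly_clear_denominator[of d "\<lambda>t. f (n + t)"] f z0 by metis
    have "Fract (\<Sum>t\<le>d. poly (c t) (monom 1 n) * Q t) 1 =
        (\<Sum>t\<le>d. subst_q n (c t) * (Fract (monom 1 M) 1 * f (n + t)))"
      unfolding Fract_sum by (intro sum.cong) (auto simp: Q subst_q_def)
    also have "\<dots> = Fract (monom 1 M) 1 * (\<Sum>t\<le>d. subst_q n (c t) * f (n + t))"
      by (simp add: sum_distrib_left mult.left_commute)
    also have "\<dots> = 0"
      by (simp add: rec)
    finally have "(\<Sum>t\<le>d. poly (c t) (monom 1 n) * Q t) = 0"
      by (simp add: Zero_fract_def eq_fract)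
    then have "pcompose (\<Sum>t\<le>d. poly (c t) (monom 1 n) * Q t) [:z, 1:] = 0"
      by simp
    then have "(\<Sum>t\<le>d. b t n * pcompose (Q t) [:z, 1:]) = 0"
      by (simp add: pcompose_sum pcompose_mult b_def)
    then have "0 = coeff (\<Sum>t\<le>d. b t n * pcompose (Q t) [:z, 1:]) k"
      by simp
    also have "\<dots> = (\<Sum>t\<le>d. \<Sum>i\<le>k. coeff (b t n) i * coeff (pcompose (Q t) [:z, 1:]) (k - i))"
      by (simp add: coeff_sum coeff_mult)
    also have "\<dots> = (\<Sum>t\<le>d. coeff (b t n) k * poly (Q t) z)"
    proof (intro sum.cong refl)
      fix t assume "t \<in> {..d}"
      then have "(\<Sum>i<k. coeff (b t n) i * coeff (pcompose (Q t) [:z, 1:]) (k - i)) = 0"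
        using below by (intro sum.neutral) auto
      then show "(\<Sum>i\<le>k. coeff (b t n) i * coeff (pcompose (Q t) [:z, 1:]) (k - i)) =
          coeff (b t n) k * poly (Q t) z"
        by (simp flip: lessThan_Suc_atMost)
    qed
    also have "\<dots> = z ^ M * (\<Sum>t\<le>d. poly (p t) (of_nat n) * eval_rat_fun (f (n + t)) z)"
      by (simp add: p Q sum_distrib_left mult.left_commute)
    finally show ?thesis
      using z0 by simp
  qed
  \<comment> \<open>Some of the $p_t$ may vanish, so the order of the recursion is the last $t$ with
    $p_t \neq 0$.\<close>
  define d' where "d' = Max {t. t \<le> d \<and> p t \<noteq> 0}"
  have "{t. t \<le> d \<and> p t \<noteq> 0} \<noteq> {}"
    using k p(2) by auto
  then have "d' \<in> {t. t \<le> d \<and> p t \<noteq> 0}"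
    unfolding d'_def by (intro Max_in) auto
  then have d': "d' \<le> d" "p d' \<noteq> 0"
    by auto
  have above: "p t = 0" if "t \<le> d" "\<not> t \<le> d'" for t
  proof (rule ccontr)
    assume "p t \<noteq> 0"
    then have "t \<le> d'"
      unfolding d'_def using that by (intro Max_ge) auto
    then show False
      using that by simp
  qed
  have "(\<Sum>t\<le>d'. poly (p t) (of_nat n) * eval_rat_fun (f (n + t)) z) =
      (\<Sum>t\<le>d. poly (p t) (of_nat n) * eval_rat_fun (f (n + t)) z)" for n
    using d'(1) above by (intro sum.mono_neutral_left) auto
  then show ?thesis
    unfolding holonomic_def using L d' p(1) lowest
    by (intro exI[of _ L] exI[of _ d'] exI[of _ p]) (auto intro!: polys_overD)
qed

theorem theorem1p5:
  fixes f :: "nat \<Rightarrow> complex poly fract" and \<zeta> :: complex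
  assumes "q_holonomic f"
    and "\<And>n. f n \<in> int_laurent_polys"
    and "root_of_unity \<zeta>"
  shows "holonomic (\<lambda>n. eval_rat_fun (f n) \<zeta>)"
proof -
  obtain K d c where K: "number_field K"
    and c: "\<forall>j\<le>d. \<forall>i k. coeff (coeff (c j) i) k \<in> K" "c d \<noteq> 0"
    and rec: "\<And>n. (\<Sum>j\<le>d. subst_q n (c j) * f (n + j)) = 0"
    using assms(1) unfolding q_holonomic_def by blast
  obtain N where N: "N > 0" "\<zeta> ^ N = 1"
    using assms(3) by (auto simp: root_of_unity_def)
  obtain L where L: "number_field L" "K \<subseteq> L" "\<zeta> \<in> L"
    using number_field_adjoin_root_of_unity[OF K assms(3)] .
  have R: "unital_subring L"
    using L(1) by (rule unital_subring_number_field)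
  have cL: "c l \<in> polys_over (polys_over L)" if "l \<le> d" for l
    using that c(1) L(2) by (auto simp: polys_over_def)
  obtain m a where a: "\<And>s. s \<le> m \<Longrightarrow> a s \<in> polys_over (polys_over L)" "\<exists>s\<le>m. a s \<noteq> 0"
    "\<And>t e. t \<le> m + d \<Longrightarrow> \<not> N dvd e \<Longrightarrow> coeff (skew_mult m a d c t) e = 0"
    using skew_multiple_in_powers[of L d c N, OF R cL N(1)] by blast
  show ?thesis
  proof (rule holonomic_if_recurrence_in_powers[OF L(1,3) N(2,1) assms(2)])
    show "skew_mult m a d c t \<in> polys_over (polys_over L)" for t
      by (rule skew_mult_in_polys_over[OF R a(1) cL])
    show "\<exists>t\<le>m + d. skew_mult m a d c t \<noteq> 0"
      using skew_mult_nonzero[of m a c d, OF a(2) c(2)] by blast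
    show "(\<Sum>t\<le>m + d. subst_q n (skew_mult m a d c t) * f (n + t)) = 0" for n
      by (rule skew_mult_annihilates[OF rec])
  qed (use a(3) in auto)
qed

end
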